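(* Let $L$ be a modular, l.f.f.c. lattice. Then the skeleton lattice $S$ of blocks of $L$, the dissection tolerance $\gamma$, the blocks $L_B=B$ indexed by themselves ($B\in S$), and the connections $\varphi_B^C$ (for $B\le C$ with $B\cap C\ne\emptyset$, the identity map on $B\cap C$, with source $F_B^C=B\cap C$ and target $I_B^C=B\cap C$) form a modular connected system.
   Context: A lattice is locally finite if every closed interval is finite; it has finite covers if every element has finitely many upper and lower covers; it is l.f.f.c. if both hold. $x\lessdot y$ means $y$ covers $x$. For $x\in L$, $x^*=x$ if $x$ is the top of $L$, otherwise the join of all upper covers of $x$; dually $x_*$ (meet of lower covers, or $x$ if $x$ is the bottom). A block of $L$ is a maximal (under inclusion) complemented interval $B=[0_B,1_B]$ of $L$. The skeleton $S$ is the set of blocks ordered by $B\le C$ iff $0_B\le 0_C$ (equivalently $1_B\le 1_C$); it is a lattice. The dissection tolerance is $B\,\gamma\,C$ iff $B\cap C\ne\emptyset$. Each block is regarded as a lattice with the order of $L$. A tolerance on a lattice $S$ is a reflexive, symmetric relation $\gamma$ with $a\,\gamma\,b$, $c\,\gamma\,d$ implying $(a\vee c)\,\gamma\,(b\vee d)$ and $(a\wedge c)\,\gamma\,(b\wedge d)$; $x\le_\gamma y$ means $x\le y$ and $x\,\gamma\,y$. A modular connected system $(S,\gamma,(L_x)_{x\in S},(\varphi_x^y)_{x\le_\gamma y})$ is a lattice $S$, a tolerance $\gamma$ on $S$, lattices $L_x$ and maps $\varphi_x^y$ satisfying: (MC1) $S$ is l.f.f.c.; (MC2) each $L_x$ is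 finite, modular, complemented; (MC3) each $\varphi_x^y$ is a lattice isomorphism from a nonempty lattice filter $F_x^y$ of $L_x$ onto a lattice ideal $I_x^y$ of $L_y$; (MC4) $F_x^x=I_x^x=L_x$, $\varphi_x^x=\mathrm{id}$; (MC5) if $x\le_\gamma y\le_\gamma z$ and $I_x^y\cap F_y^z\neq\emptyset$ then $x\,\gamma\,z$; (MC6) for $x\le z\le y$ with $x\,\gamma\,y$: $F_x^y=(\varphi_x^z)^{-1}(I_x^z\cap F_z^y)$, $I_x^y=\varphi_z^y(I_x^z\cap F_z^y)$, $\varphi_x^y=\varphi_z^y\circ\varphi_x^z|_{F_x^y}$; (MC7) if $x\,\gamma\,y$ then $I_x^{x\vee y}\cap I_y^{x\vee y}\subseteq I_{x\wedge y}^{x\vee y}$ and $F_{x\wedge y}^x\cap F_{x\wedge y}^y\subseteq F_{x\wedge y}^{x\vee y}$; (MC8.1) $x\lessdot y$ implies $x\,\gamma\,y$; (MC8.2) $x\lessdot y$ implies $F_x^y\neq L_x$ and $I_x^y\neq L_y$. *)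

theory Defs
  imports "HOL-Algebra.Lattice"
begin

section \<open>Lattice-theoretic notions\<close>

text \<open>
  Lattices are the carrier-based ones of HOL-Algebra (records of type \<^typ>\<open>'a gorder\<close>).  Its locale
  \<^locale>\<open>lattice\<close> forces the record's equality to be HOL equality but admits an empty carrier.
  For \<open>B \<subseteq> carrier L\<close>, the record \<open>L\<lparr>carrier := B\<rparr>\<close> is \<open>B\<close> with the order
  of \<open>L\<close>; its joins and meets are those computed inside \<open>B\<close>.
\<close>

locale modular_lattice = lattice +
  assumes modular_law:
    "\<lbrakk>x \<in> carrier L; y \<in> carrier L; z \<in> carrier L; x \<sqsubseteq> z\<rbrakk> \<Longrightarrow> x \<squnion> (y \<sqinter> z) = (x \<squnion> y) \<sqinter> z"

locale complemented_lattice = bounded_lattice +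
  assumes complement_exists:
    "x \<in> carrier L \<Longrightarrow> \<exists>y\<in>carrier L. x \<squnion> y = \<top> \<and> x \<sqinter> y = \<bottom>"

definition covered_by :: "('a, 'm) gorder_scheme \<Rightarrow> 'a \<Rightarrow> 'a \<Rightarrow> bool"
    (infix \<open>\<lessdot>\<index>\<close> 50)
  where "x \<lessdot>\<^bsub>L\<^esub> y \<longleftrightarrow>
    x \<in> carrier L \<and> y \<in> carrier L \<and> x \<sqsubset>\<^bsub>L\<^esub> y \<and> \<not> (\<exists>z\<in>carrier L. x \<sqsubset>\<^bsub>L\<^esub> z \<and> z \<sqsubset>\<^bsub>L\<^esub> y)"

definition locally_finite :: "('a, 'm) gorder_scheme \<Rightarrow> bool"
  where "locally_finite L \<longleftrightarrow> (\<forall>a\<in>carrier L. \<forall>b\<in>carrier L. finite \<lbrace>a..b\<rbrace>\<^bsub>L\<^esub>)"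

definition has_finite_covers :: "('a, 'm) gorder_scheme \<Rightarrow> bool"
  where "has_finite_covers L \<longleftrightarrow>
    (\<forall>x\<in>carrier L. finite {y. x \<lessdot>\<^bsub>L\<^esub> y} \<and> finite {y. y \<lessdot>\<^bsub>L\<^esub> x})"

definition lffc :: "('a, 'm) gorder_scheme \<Rightarrow> bool"
  where "lffc L \<longleftrightarrow> locally_finite L \<and> has_finite_covers L"

text \<open>Filters and ideals may be empty here.\<close>

definition lattice_filter :: "('a, 'm) gorder_scheme \<Rightarrow> 'a set \<Rightarrow> bool"
  where "lattice_filter L F \<longleftrightarrow> F \<subseteq> carrier L \<and>
    (\<forall>a\<in>F. \<forall>b\<in>carrier L. a \<sqsubseteq>\<^bsub>L\<^esub> b \<longrightarrow> b \<in> F) \<and>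
    (\<forall>a\<in>F. \<forall>b\<in>F. a \<sqinter>\<^bsub>L\<^esub> b \<in> F)"

definition lattice_ideal :: "('a, 'm) gorder_scheme \<Rightarrow> 'a set \<Rightarrow> bool"
  where "lattice_ideal L I \<longleftrightarrow> I \<subseteq> carrier L \<and>
    (\<forall>a\<in>I. \<forall>b\<in>carrier L. b \<sqsubseteq>\<^bsub>L\<^esub> a \<longrightarrow> b \<in> I) \<and>
    (\<forall>a\<in>I. \<forall>b\<in>I. a \<squnion>\<^bsub>L\<^esub> b \<in> I)"

definition lattice_iso :: "('a, 'm) gorder_scheme \<Rightarrow> ('b, 'n) gorder_scheme \<Rightarrow> ('a \<Rightarrow> 'b) \<Rightarrow> bool"
  where "lattice_iso X Y f \<longleftrightarrow>
    bij_betw f (carrier X) (carrier Y) \<and> join_pres X Y f \<and> meet_pres X Y f"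

section \<open>Blocks, skeleton and dissection tolerance\<close>

definition complemented_interval :: "('a, 'm) gorder_scheme \<Rightarrow> 'a set \<Rightarrow> bool"
  where "complemented_interval L B \<longleftrightarrow>
    (\<exists>a\<in>carrier L. \<exists>b\<in>carrier L. a \<sqsubseteq>\<^bsub>L\<^esub> b \<and> B = \<lbrace>a..b\<rbrace>\<^bsub>L\<^esub>) \<and>
    complemented_lattice (L\<lparr>carrier := B\<rparr>)"

definition blocks :: "('a, 'm) gorder_scheme \<Rightarrow> 'a set set"
  where "blocks L =
    {B. complemented_interval L B \<and> (\<forall>C. complemented_interval L C \<and> B \<subseteq> C \<longrightarrow> C = B)}"

definition block_bot :: "('a, 'm) gorder_scheme \<Rightarrow> 'a set \<Rightarrow> 'a"
  where "block_bot L B = \<bottom>\<^bsub>L\<lparr>carrier := B\<rparr>\<^esub>"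

definition skeleton :: "('a, 'm) gorder_scheme \<Rightarrow> 'a set gorder"
  where "skeleton L =
    \<lparr>carrier = blocks L, eq = (=), le = (\<lambda>B C. block_bot L B \<sqsubseteq>\<^bsub>L\<^esub> block_bot L C)\<rparr>"

definition dissection_tolerance :: "('a, 'm) gorder_scheme \<Rightarrow> 'a set rel"
  where "dissection_tolerance L = {(B, C). B \<in> blocks L \<and> C \<in> blocks L \<and> B \<inter> C \<noteq> {}}"

section \<open>Modular connected systems\<close>

locale lattice_tolerance = lattice S for S :: "('i, 'm) gorder_scheme" (structure) +
  fixes \<gamma> :: "'i rel"
  assumes tol_subset: "\<gamma> \<subseteq> carrier S \<times> carrier S"
    and tol_refl: "refl_on (carrier S) \<gamma>"
    and tol_sym: "sym \<gamma>"
    and tol_join: "\<lbrakk>(a, b) \<in> \<gamma>; (c, d) \<in> \<gamma>\<rbrakk> \<Longrightarrow> (a \<squnion> c, b \<squnion> d) \<in> \<gamma>"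
    and tol_meet: "\<lbrakk>(a, b) \<in> \<gamma>; (c, d) \<in> \<gamma>\<rbrakk> \<Longrightarrow> (a \<sqinter> c, b \<sqinter> d) \<in> \<gamma>"

definition tol_le :: "('i, 'm) gorder_scheme \<Rightarrow> 'i rel \<Rightarrow> 'i \<Rightarrow> 'i \<Rightarrow> bool"
  where "tol_le S \<gamma> x y \<longleftrightarrow> x \<sqsubseteq>\<^bsub>S\<^esub> y \<and> (x, y) \<in> \<gamma>"

text \<open>
  A connection with source \<open>F x y\<close> and target \<open>I x y\<close> is represented by the two sets together with
  a total HOL function \<open>\<phi> x y\<close>, of which only the values on \<open>F x y\<close> matter; all three are
  unconstrained unless \<open>tol_le S \<gamma> x y\<close>.  As usual, \<open>S\<close> is a nonempty lattice.
\<close>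

locale modular_connected_system = lattice_tolerance S \<gamma>
  for S :: "('i, 'm) gorder_scheme" (structure) and \<gamma> :: "'i rel" +
  fixes M :: "'i \<Rightarrow> ('b, 'n) gorder_scheme"
    and F :: "'i \<Rightarrow> 'i \<Rightarrow> 'b set"
    and I :: "'i \<Rightarrow> 'i \<Rightarrow> 'b set"
    and \<phi> :: "'i \<Rightarrow> 'i \<Rightarrow> 'b \<Rightarrow> 'b"
  assumes nonempty: "carrier S \<noteq> {}"
    and MC1: "lffc S"
    and MC2: "x \<in> carrier S \<Longrightarrow>
      finite (carrier (M x)) \<and> modular_lattice (M x) \<and> complemented_lattice (M x)"
    and MC3: "tol_le S \<gamma> x y \<Longrightarrow>
      F x y \<noteq> {} \<and> lattice_filter (M x) (F x y) \<and> lattice_ideal (M y) (I x y) \<and>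
      lattice_iso ((M x)\<lparr>carrier := F x y\<rparr>) ((M y)\<lparr>carrier := I x y\<rparr>) (\<phi> x y)"
    and MC4: "x \<in> carrier S \<Longrightarrow>
      F x x = carrier (M x) \<and> I x x = carrier (M x) \<and> (\<forall>a\<in>carrier (M x). \<phi> x x a = a)"
    and MC5: "\<lbrakk>tol_le S \<gamma> x y; tol_le S \<gamma> y z; I x y \<inter> F y z \<noteq> {}\<rbrakk> \<Longrightarrow> (x, z) \<in> \<gamma>"
    and MC6: "\<lbrakk>z \<in> carrier S; x \<sqsubseteq> z; z \<sqsubseteq> y; (x, y) \<in> \<gamma>\<rbrakk> \<Longrightarrow>
      F x y = {a \<in> F x z. \<phi> x z a \<in> I x z \<inter> F z y} \<and>
      I x y = \<phi> z y ` (I x z \<inter> F z y) \<and>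
      (\<forall>a\<in>F x y. \<phi> x y a = \<phi> z y (\<phi> x z a))"
    and MC7: "(x, y) \<in> \<gamma> \<Longrightarrow>
      I x (x \<squnion> y) \<inter> I y (x \<squnion> y) \<subseteq> I (x \<sqinter> y) (x \<squnion> y) \<and>
      F (x \<sqinter> y) x \<inter> F (x \<sqinter> y) y \<subseteq> F (x \<sqinter> y) (x \<squnion> y)"
    and MC8_1: "x \<lessdot> y \<Longrightarrow> (x, y) \<in> \<gamma>"
    and MC8_2: "x \<lessdot> y \<Longrightarrow> F x y \<noteq> carrier (M x) \<and> I x y \<noteq> carrier (M y)"

end

theory Submission
  imports Defs
begin

text \<open>
  The pair \<open>b \<mapsto> b\<^sub>*\<close>, \<open>a \<mapsto> a\<^sup>*\<close> is a Galois connection: \<open>b \<sqsubseteq> a\<^sup>*\<close> iff \<open>b\<^sub>* \<sqsubseteq> a\<close>.  The reason is that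
  in a modular lattice complementedness of an interval is preserved by translation with \<open>- \<squnion> c\<close> and
  \<open>- \<sqinter> c\<close>.  The blocks are the intervals between the closed pairs \<open>b = a\<^sup>*\<close>, \<open>a = b\<^sub>*\<close> of this
  connection, so bottoms of blocks are closed under joins and tops of blocks under meets, and two
  blocks meet iff the bottom of each lies below the top of the other.  If a block \<open>C\<close> covers \<open>B\<close> in
  the skeleton, an upper cover \<open>q \<sqsubseteq> 1\<^sub>C\<close> of \<open>1\<^sub>B\<close> gives the block bottom \<open>q\<^sub>*\<close>, strictly above \<open>0\<^sub>B\<close>, hence
  \<open>0\<^sub>C = q\<^sub>* \<sqsubseteq> 1\<^sub>B\<close>; this is (MC8.1), from which finiteness of the covers in the skeleton follows.
\<close>

section \<open>Relatively complemented pairs in a modular lattice\<close>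

text \<open>The joins and meets are those of \<open>L\<close> itself, and the complement is sought
  in all of \<open>L\<close>: since \<open>x \<sqinter> y = a\<close> and
  \<open>x \<squnion> y = b\<close>, it lies between \<open>a\<close> and \<open>b\<close> anyway.
  The condition is self-dual.\<close>

definition rel_complemented :: "('a, 'm) gorder_scheme \<Rightarrow> 'a \<Rightarrow> 'a \<Rightarrow> bool"
  where "rel_complemented L a b \<longleftrightarrow>
    a \<in> carrier L \<and> b \<in> carrier L \<and> a \<sqsubseteq>\<^bsub>L\<^esub> b \<and>
    (\<forall>x\<in>carrier L. a \<sqsubseteq>\<^bsub>L\<^esub> x \<and> x \<sqsubseteq>\<^bsub>L\<^esub> b \<longrightarrow>
      (\<exists>y\<in>carrier L. x \<squnion>\<^bsub>L\<^esub> y = b \<and> x \<sqinter>\<^bsub>L\<^esub> y = a))"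

lemma rel_complemented_dual [simp]:
  "rel_complemented (inv_gorder L) b a \<longleftrightarrow> rel_complemented L a b"
  by (auto simp: rel_complemented_def)

lemma rel_complementedD:
  assumes "rel_complemented L a b"
  shows "a \<in> carrier L" "b \<in> carrier L" "a \<sqsubseteq>\<^bsub>L\<^esub> b"
  using assms by (auto simp: rel_complemented_def)

context lattice
begin

lemma join_assoc:
  "\<lbrakk>x \<in> carrier L; y \<in> carrier L; z \<in> carrier L\<rbrakk> \<Longrightarrow> (x \<squnion> y) \<squnion> z = x \<squnion> (y \<squnion> z)"
  using weak_join_assoc by (simp add: eq_is_equal)

lemma meet_assoc:
  "\<lbrakk>x \<in> carrier L; y \<in> carrier L; z \<in> carrier L\<rbrakk> \<Longrightarrow> (x \<sqinter> y) \<sqinter> z = x \<sqinter> (y \<sqinter> z)"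
  using weak_meet_assoc by (simp add: eq_is_equal)

lemma join_absorb: "\<lbrakk>x \<in> carrier L; y \<in> carrier L; x \<sqsubseteq> y\<rbrakk> \<Longrightarrow> x \<squnion> y = y"
  using le_iff_meet by blast

lemma meet_absorb: "\<lbrakk>x \<in> carrier L; y \<in> carrier L; x \<sqsubseteq> y\<rbrakk> \<Longrightarrow> x \<sqinter> y = x"
  using le_iff_join by metis

lemma rel_complemented_refl: "a \<in> carrier L \<Longrightarrow> rel_complemented L a a"
  by (metis join_absorb le_antisym le_refl meet_absorb rel_complemented_def)

end

context modular_lattice
begin

text \<open>The modular law is its own dual with the outer variables exchanged, so each later result
  can also be used upside down.\<close>

lemma dual_modular_lattice: "modular_lattice (inv_gorder L)"
proof -
  interpret dual: lattice "inv_gorder L" by (rule dual_lattice)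
  show ?thesis
  proof
    fix x y z
    assume "x \<in> carrier (inv_gorder L)" "y \<in> carrier (inv_gorder L)"
      "z \<in> carrier (inv_gorder L)" "x \<sqsubseteq>\<^bsub>inv_gorder L\<^esub> z"
    then show "x \<squnion>\<^bsub>inv_gorder L\<^esub> (y \<sqinter>\<^bsub>inv_gorder L\<^esub> z) =
        (x \<squnion>\<^bsub>inv_gorder L\<^esub> y) \<sqinter>\<^bsub>inv_gorder L\<^esub> z"
      using modular_law[of z y x] by (simp add: join_comm[of L] meet_comm[of L])
  qed
qed

text \<open>A complement in \<open>[a, b \<squnion> b']\<close> is assembled in two steps: the first takes \<open>x\<close> up to \<open>x \<squnion> b\<close>,
  the second from there to \<open>b \<squnion> b'\<close>.\<close>

lemma rel_complemented_join:
  assumes ab: "rel_complemented L a b" and ab': "rel_complemented L a b'"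
  shows "rel_complemented L a (b \<squnion> b')"
proof -
  note c [simp] = rel_complementedD(1,2)[OF ab] rel_complementedD(1,2)[OF ab']
  note le = rel_complementedD(3)[OF ab] rel_complementedD(3)[OF ab']
  have "\<exists>w\<in>carrier L. x \<squnion> w = b \<squnion> b' \<and> x \<sqinter> w = a"
    if x [simp]: "x \<in> carrier L" and ax: "a \<sqsubseteq> x" and xb: "x \<sqsubseteq> b \<squnion> b'" for x
  proof -
    \<comment> \<open>\<open>y\<close> complements \<open>x \<sqinter> b\<close> in
      \<open>[a, b]\<close>; because \<open>y\<close> lies below \<open>b\<close>, its meet with
      \<open>x\<close> itself is already \<open>a\<close>.\<close>
    obtain y where y [simp]: "y \<in> carrier L" and y1: "(x \<sqinter> b) \<squnion> y = b" and y2: "(x \<sqinter> b) \<sqinter> y = a"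
      using ab ax le unfolding rel_complemented_def by (metis meet_closed meet_le meet_right x)
    define z where "z = x \<squnion> y"
    have z [simp]: "z \<in> carrier L" by (simp add: z_def)
    have yb: "y \<sqsubseteq> b" using y1 by (metis c(2) join_right meet_closed x y)
    have xy: "x \<sqinter> y = a"
      using y2 yb by (metis c(2) meet_absorb meet_assoc meet_comm x y)
    have bz: "b \<sqsubseteq> z"
    proof -
      have "(x \<sqinter> b) \<squnion> y \<sqsubseteq> z" unfolding z_def
        by (rule join_le) (auto intro: le_trans[OF meet_left join_left] join_right)
      then show ?thesis by (simp add: y1)
    qed
    have zb: "z \<sqsubseteq> b \<squnion> b'" unfolding z_def
      by (rule join_le) (auto intro: xb le_trans[OF yb join_left])
    have az: "a \<sqsubseteq> z" by (rule le_trans[OF le(1) bz]) auto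
    \<comment> \<open>The same construction, with \<open>z = x \<squnion> y\<close> and
      \<open>b'\<close> in place of \<open>x\<close> and \<open>b\<close>.\<close>
    obtain y' where y' [simp]: "y' \<in> carrier L"
      and y'1: "(z \<sqinter> b') \<squnion> y' = b'" and y'2: "(z \<sqinter> b') \<sqinter> y' = a"
      using ab' az le unfolding rel_complemented_def by (metis meet_closed meet_le meet_right z)
    have y'b: "y' \<sqsubseteq> b'" using y'1 by (metis c(4) join_right meet_closed z y')
    have zy': "z \<sqinter> y' = a"
      using y'2 y'b by (metis c(4) meet_absorb meet_assoc meet_comm z y')
    have ay: "a \<sqsubseteq> y" using xy by (metis meet_right x y)
    have w [simp]: "y \<squnion> y' \<in> carrier L" by simp
    have "b' \<sqsubseteq> z \<squnion> y'"
    proof -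
      have "(z \<sqinter> b') \<squnion> y' \<sqsubseteq> z \<squnion> y'"
        by (rule join_le) (auto intro: le_trans[OF meet_left join_left] join_right)
      then show ?thesis by (simp add: y'1)
    qed
    then have "b \<squnion> b' \<sqsubseteq> z \<squnion> y'"
      by (intro join_le) (auto intro: le_trans[OF bz join_left])
    moreover have "z \<squnion> y' \<sqsubseteq> b \<squnion> b'"
      by (rule join_le) (auto intro: zb le_trans[OF y'b join_right])
    ultimately have "z \<squnion> y' = b \<squnion> b'" by (intro le_antisym) auto
    then have j: "x \<squnion> (y \<squnion> y') = b \<squnion> b'" by (simp add: z_def join_assoc)
    have yz: "y \<sqsubseteq> z" by (simp add: z_def join_right)
    \<comment> \<open>As \<open>x\<close> lies below \<open>z\<close>, its meet with
      \<open>y \<squnion> y'\<close> may be computed below \<open>z\<close>, where modularity cuts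
      \<open>y \<squnion> y'\<close> down to \<open>y\<close>.\<close>
    have "(y \<squnion> y') \<sqinter> z = y \<squnion> (y' \<sqinter> z)"
      using modular_law[of y y' z] yz by simp
    also have "\<dots> = y"
      using zy' ay by (metis c(1) join_absorb join_comm meet_comm y)
    finally have wz: "(y \<squnion> y') \<sqinter> z = y" .
    have "x \<sqinter> z = x" by (rule meet_absorb) (auto simp: z_def join_left)
    then have "x \<sqinter> (y \<squnion> y') = x \<sqinter> ((y \<squnion> y') \<sqinter> z)"
      by (metis meet_assoc meet_comm w x z)
    then have "x \<sqinter> (y \<squnion> y') = a" by (simp add: wz xy)
    with j show ?thesis by (intro bexI[of _ "y \<squnion> y'"]) auto
  qed
  moreover have "a \<sqsubseteq> b \<squnion> b'" by (rule le_trans[OF le(1) join_left]) auto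
  ultimately show ?thesis by (auto simp: rel_complemented_def)
qed

text \<open>If \<open>y\<close> is a complement of \<open>x \<sqinter> b\<close> in
  \<open>[a, b]\<close>, then \<open>y \<squnion> c\<close> is the complement of \<open>x\<close>;
  the modular law computes the meet because \<open>c\<close> lies below \<open>x\<close>.\<close>

lemma rel_complemented_translate:
  assumes ab: "rel_complemented L a b" and c [simp]: "c \<in> carrier L"
  shows "rel_complemented L (a \<squnion> c) (b \<squnion> c)"
proof -
  note c' [simp] = rel_complementedD(1,2)[OF ab]
  note le = rel_complementedD(3)[OF ab]
  have "\<exists>w\<in>carrier L. x \<squnion> w = b \<squnion> c \<and> x \<sqinter> w = a \<squnion> c"
    if x [simp]: "x \<in> carrier L" and ax: "a \<squnion> c \<sqsubseteq> x" and xb: "x \<sqsubseteq> b \<squnion> c" for x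
  proof -
    have ax': "a \<sqsubseteq> x" and cx: "c \<sqsubseteq> x"
      using le_trans[OF join_left ax] le_trans[OF join_right ax] by simp_all
    obtain y where y [simp]: "y \<in> carrier L" and y1: "(x \<sqinter> b) \<squnion> y = b" and y2: "(x \<sqinter> b) \<sqinter> y = a"
      using ab ax' le unfolding rel_complemented_def by (metis c'(2) meet_closed meet_le meet_right x)
    have yb: "y \<sqsubseteq> b" using y1 by (metis c'(2) join_right meet_closed x y)
    have xy: "x \<sqinter> y = a"
      using y2 yb by (metis c'(2) meet_absorb meet_assoc meet_comm x y)
    have "(x \<sqinter> b) \<squnion> y \<sqsubseteq> x \<squnion> (y \<squnion> c)"
      by (rule join_le) (auto intro: le_trans[OF meet_left join_left] le_trans[OF join_left join_right])
    then have "b \<squnion> c \<sqsubseteq> x \<squnion> (y \<squnion> c)"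
      by (intro join_le) (auto simp: y1 intro: le_trans[OF join_right join_right])
    moreover have "x \<squnion> (y \<squnion> c) \<sqsubseteq> b \<squnion> c"
      by (intro join_le) (auto intro: xb join_right le_trans[OF yb join_left])
    ultimately have j: "x \<squnion> (y \<squnion> c) = b \<squnion> c" by (intro le_antisym) auto
    have "x \<sqinter> (y \<squnion> c) = a \<squnion> c"
      using modular_law[of c y x] cx xy by (simp add: join_comm[of L] meet_comm[of L])
    with j show ?thesis by (intro bexI[of _ "y \<squnion> c"]) auto
  qed
  moreover have "a \<squnion> c \<sqsubseteq> b \<squnion> c" 
    by (rule join_le) (auto intro: join_right le_trans[OF le join_left])
  ultimately show ?thesis by (auto simp: rel_complemented_def)
qed

end


section \<open>The star operators\<close>

text \<open>
  \<open>upper_star L a\<close> is the \<open>a\<^sup>*\<close> of the paper, characterised without covers: for \<open>a \<sqsubseteq> b\<close> the interval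
  from \<open>a\<close> to \<open>b\<close> is complemented iff \<open>b \<sqsubseteq> a\<^sup>*\<close>, so \<open>a\<^sup>*\<close> is the greatest such \<open>b\<close>.  The choice is
  meaningful only in a modular l.f.f.c. lattice.
\<close>

definition upper_star :: "('a, 'm) gorder_scheme \<Rightarrow> 'a \<Rightarrow> 'a"
  where "upper_star L a =
    (SOME b. rel_complemented L a b \<and> (\<forall>c. rel_complemented L a c \<longrightarrow> c \<sqsubseteq>\<^bsub>L\<^esub> b))"

definition lower_star :: "('a, 'm) gorder_scheme \<Rightarrow> 'a \<Rightarrow> 'a"
  where "lower_star L b = upper_star (inv_gorder L) b"

locale lffc_modular_lattice = modular_lattice +
  assumes lffc: "lffc L"
begin

section \<open>Existence of the greatest complemented interval above an element\<close>

lemma finite_interval: "\<lbrakk>a \<in> carrier L; b \<in> carrier L\<rbrakk> \<Longrightarrow> finite \<lbrace>a..b\<rbrace>"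
  using lffc by (auto simp: lffc_def locally_finite_def)

text \<open>Among the elements strictly above \<open>x\<close> and at most \<open>y\<close>, take
  \<open>p\<close> with the fewest elements in \<open>[x, p]\<close>; an element strictly between
  \<open>x\<close> and \<open>p\<close> would have a smaller interval.\<close>

lemma exists_upper_cover:
  assumes x: "x \<in> carrier L" and y: "y \<in> carrier L" and xy: "x \<sqsubset> y"
  obtains p where "x \<lessdot> p" "p \<sqsubseteq> y"
proof -
  let ?P = "\<lambda>z. z \<in> carrier L \<and> x \<sqsubset> z \<and> z \<sqsubseteq> y"
  obtain p where p: "?P p" and min: "\<And>z. ?P z \<Longrightarrow> card \<lbrace>x..p\<rbrace> \<le> card \<lbrace>x..z\<rbrace>"
    using ex_has_least_nat[of ?P y "\<lambda>z. card \<lbrace>x..z\<rbrace>"] xy y by auto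
  have "\<not> (x \<sqsubset> z \<and> z \<sqsubset> p)" if z: "z \<in> carrier L" for z
  proof
    assume zp: "x \<sqsubset> z \<and> z \<sqsubset> p"
    then have "\<lbrace>x..z\<rbrace> \<subset> \<lbrace>x..p\<rbrace>"
      using p x z by (auto simp: at_least_at_most_def lless_eq intro: le_trans)
    then have "card \<lbrace>x..z\<rbrace> < card \<lbrace>x..p\<rbrace>"
      using finite_interval p x by (intro psubset_card_mono) auto
    moreover have "?P z" using zp p y z by (auto simp: lless_eq intro: le_trans)
    ultimately show False using min by fastforce
  qed
  then have "x \<lessdot> p" using p x by (auto simp: covered_by_def)
  with p show ?thesis by (intro that) auto
qed

text \<open>Let \<open>y\<close> be a complement of \<open>b \<sqinter> u\<close> in
  \<open>[a, b]\<close>. An upper cover of \<open>a\<close> below \<open>y\<close> would lie below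
  both \<open>y\<close> and \<open>b \<sqinter> u\<close>, whose meet is \<open>a\<close>. So
  \<open>y = a\<close> and \<open>b \<sqinter> u = b\<close>.\<close>

lemma rel_complemented_le:
  assumes ab: "rel_complemented L a b" and u [simp]: "u \<in> carrier L" and au: "a \<sqsubseteq> u"
    and covers: "\<And>p. a \<lessdot> p \<Longrightarrow> p \<sqsubseteq> u"
  shows "b \<sqsubseteq> u"
proof -
  note c [simp] = rel_complementedD(1,2)[OF ab]
  have "a \<sqsubseteq> b \<sqinter> u" by (rule meet_le) (auto simp: au rel_complementedD(3)[OF ab])
  then obtain y where y [simp]: "y \<in> carrier L" and y1: "(b \<sqinter> u) \<squnion> y = b" and y2: "(b \<sqinter> u) \<sqinter> y = a"
    using ab unfolding rel_complemented_def by (metis meet_closed meet_left u)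
  have ay: "a \<sqsubseteq> y" using y2 by (metis c(2) meet_closed meet_right u y)
  have yb: "y \<sqsubseteq> b" using y1 by (metis c(2) join_right meet_closed u y)
  have "y = a"
  proof (rule ccontr)
    assume "y \<noteq> a"
    then obtain p where p: "a \<lessdot> p" "p \<sqsubseteq> y"
      using exists_upper_cover[of a y] ay by (auto simp: lless_eq)
    then have [simp]: "p \<in> carrier L" and ap: "a \<sqsubset> p" by (auto simp: covered_by_def)
    have "p \<sqsubseteq> (b \<sqinter> u) \<sqinter> y"
      by (intro meet_le) (auto intro: p covers le_trans[OF p(2) yb])
    with y2 ap show False by (auto simp: lless_eq)
  qed
  then have "b \<sqinter> u = b" using y1 y2 by (metis c join_absorb join_comm meet_closed meet_right u \<open>a \<sqsubseteq> b \<sqinter> u\<close>)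
  then show ?thesis by (metis c(2) meet_right u)
qed

text \<open>A bound \<open>u\<close> of the finitely many upper covers of \<open>a\<close> bounds
  all complemented intervals starting at \<open>a\<close>, so one of them has maximal size. Closure
  under joins makes its top the greatest.\<close>

lemma exists_greatest_rel_complemented:
  assumes a [simp]: "a \<in> carrier L"
  shows "\<exists>b. rel_complemented L a b \<and> (\<forall>c. rel_complemented L a c \<longrightarrow> c \<sqsubseteq> b)"
proof -
  \<comment> \<open>\<open>a\<close> is included to keep the set nonempty when \<open>a\<close> has
    no upper cover.\<close>
  define A where "A = insert a {p. a \<lessdot> p}"
  have fin: "finite A" "A \<subseteq> carrier L" "A \<noteq> {}"
    using lffc by (auto simp: A_def lffc_def has_finite_covers_def covered_by_def)
  then obtain u where u [simp]: "u \<in> carrier L" and Au: "\<And>p. p \<in> A \<Longrightarrow> p \<sqsubseteq> u"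
    using finite_sup_least[OF fin] by (metis least_Upper_above least_closed)
  have bound: "b \<sqsubseteq> u" if "rel_complemented L a b" for b
    using that by (rule rel_complemented_le) (auto intro: Au simp: A_def)
  have "card \<lbrace>a..b\<rbrace> < Suc (card \<lbrace>a..u\<rbrace>)" if b: "rel_complemented L a b" for b
    unfolding less_Suc_eq_le
    using bound[OF b] rel_complementedD[OF b]
    by (intro card_mono finite_interval) (auto simp: at_least_at_most_def intro: le_trans)
  then obtain b where b: "rel_complemented L a b"
    and max: "\<And>c. rel_complemented L a c \<Longrightarrow> card \<lbrace>a..c\<rbrace> \<le> card \<lbrace>a..b\<rbrace>"
    using ex_has_greatest_nat[of "rel_complemented L a" a "\<lambda>b. card \<lbrace>a..b\<rbrace>"] rel_complemented_refl[OF a]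
    by metis
  note cb [simp] = rel_complementedD[OF b]
  have "c \<sqsubseteq> b" if c: "rel_complemented L a c" for c
  proof -
    note cc [simp] = rel_complementedD[OF c]
    have ab: "a \<sqsubseteq> b \<squnion> c" by (rule le_trans[OF cb(3) join_left]) auto
    have "\<lbrace>a..b\<rbrace> \<subseteq> \<lbrace>a..b \<squnion> c\<rbrace>"
      by (auto simp: at_least_at_most_def intro: le_trans[OF _ join_left])
    \<comment> \<open>The join is again the top of a complemented interval, so maximality forbids a
      proper enlargement.\<close>
    then have "\<lbrace>a..b\<rbrace> = \<lbrace>a..b \<squnion> c\<rbrace>"
      by (intro card_seteq finite_interval max rel_complemented_join b c) auto
    moreover have "b \<squnion> c \<in> \<lbrace>a..b \<squnion> c\<rbrace>" using ab by (auto simp: at_least_at_most_def)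
    ultimately have "b \<squnion> c \<sqsubseteq> b" by (auto simp: at_least_at_most_def)
    then show ?thesis by (rule le_trans[rotated]) (auto intro: join_right)
  qed
  with b show ?thesis by blast
qed

section \<open>The stars as a Galois connection\<close>

lemma rel_complemented_upper_star: "a \<in> carrier L \<Longrightarrow> rel_complemented L a (upper_star L a)"
  and le_upper_star: "rel_complemented L a c \<Longrightarrow> c \<sqsubseteq> upper_star L a"
  unfolding upper_star_def
  using someI_ex[OF exists_greatest_rel_complemented] rel_complementedD(1) by metis+

text \<open>Reversing the order swaps upper and lower covers and keeps each interval as a set. Facts
  on \<open>lower_star\<close> therefore follow from those on \<open>upper_star\<close>.\<close>

lemma dual_lffc_modular_lattice: "lffc_modular_lattice (inv_gorder L)"
proof -
  interpret dual: modular_lattice "inv_gorder L" by (rule dual_modular_lattice)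
  have "covered_by (inv_gorder L) x y \<longleftrightarrow> y \<lessdot> x" for x y
    by (auto simp: covered_by_def lless_eq dual.lless_eq)
  moreover have "at_least_at_most (inv_gorder L) x y = \<lbrace>y..x\<rbrace>" for x y
    by (auto simp: at_least_at_most_def)
  ultimately show ?thesis
    using lffc by unfold_locales (auto simp: lffc_def locally_finite_def has_finite_covers_def)
qed

lemma rel_complemented_lower_star: "b \<in> carrier L \<Longrightarrow> rel_complemented L (lower_star L b) b"
  using lffc_modular_lattice.rel_complemented_upper_star[OF dual_lffc_modular_lattice, of b]
  unfolding lower_star_def by simp

lemma lower_star_le: "rel_complemented L c b \<Longrightarrow> lower_star L b \<sqsubseteq> c"
  using lffc_modular_lattice.le_upper_star[OF dual_lffc_modular_lattice, of b c]
  unfolding lower_star_def by simp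

lemma star_closed [simp]:
  assumes "a \<in> carrier L"
  shows "upper_star L a \<in> carrier L" "lower_star L a \<in> carrier L"
  using assms rel_complemented_upper_star rel_complemented_lower_star rel_complementedD by metis+

lemma star_bounds [simp]:
  assumes "a \<in> carrier L"
  shows "a \<sqsubseteq> upper_star L a" "lower_star L a \<sqsubseteq> a"
  using assms rel_complemented_upper_star rel_complemented_lower_star rel_complementedD by metis+

text \<open>The interval \<open>[p, q]\<close> consists of its two ends, so it is complemented, and
  \<open>lower_star L q\<close> is the least bottom of a complemented interval ending in
  \<open>q\<close>.\<close>

lemma lower_star_le_lower_cover:
  assumes "p \<lessdot> q"
  shows "lower_star L q \<sqsubseteq> p"
proof (rule lower_star_le)
  have [simp]: "p \<in> carrier L" "q \<in> carrier L" and pq: "p \<sqsubseteq> q"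
    using assms by (auto simp: covered_by_def lless_eq)
  have "x = p \<or> x = q" if "x \<in> carrier L" "p \<sqsubseteq> x" "x \<sqsubseteq> q" for x
    using assms that by (auto simp: covered_by_def lless_eq)
  moreover have "p \<squnion> q = q" "p \<sqinter> q = p" using pq by (simp_all add: join_absorb meet_absorb)
  ultimately show "rel_complemented L p q"
    using pq unfolding rel_complemented_def
    by (metis \<open>p \<in> carrier L\<close> \<open>q \<in> carrier L\<close> join_comm meet_comm)
qed

text \<open>From left to right, meeting \<open>[a, a\<^sup>*]\<close> with \<open>b\<close> yields a
  complemented interval from \<open>a \<sqinter> b\<close> to \<open>b\<close>; from right to left,
  joining \<open>[b\<^sub>*, b]\<close> with \<open>a\<close> yields one from \<open>a\<close> to
  \<open>b \<squnion> a\<close>.\<close>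

lemma star_galois:
  assumes a [simp]: "a \<in> carrier L" and b [simp]: "b \<in> carrier L"
  shows "b \<sqsubseteq> upper_star L a \<longleftrightarrow> lower_star L b \<sqsubseteq> a"
proof
  assume le: "b \<sqsubseteq> upper_star L a"
  have "rel_complemented L (a \<sqinter> b) (upper_star L a \<sqinter> b)"
    using modular_lattice.rel_complemented_translate[OF dual_modular_lattice, of "upper_star L a" a b]
    by (simp add: rel_complemented_upper_star)
  then have "rel_complemented L (a \<sqinter> b) b"
    using le by (simp add: meet_absorb meet_comm)
  then have "lower_star L b \<sqsubseteq> a \<sqinter> b" by (rule lower_star_le)
  then show "lower_star L b \<sqsubseteq> a" by (rule le_trans[OF _ meet_left]) auto
next
  assume le: "lower_star L b \<sqsubseteq> a"
  have "rel_complemented L (lower_star L b \<squnion> a) (b \<squnion> a)"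
    by (simp add: rel_complemented_translate rel_complemented_lower_star)
  then have "rel_complemented L a (b \<squnion> a)"
    using le by (simp add: join_absorb)
  then have "b \<squnion> a \<sqsubseteq> upper_star L a" by (rule le_upper_star)
  then show "b \<sqsubseteq> upper_star L a" by (rule le_trans[rotated]) (auto intro: join_left)
qed

lemma upper_star_mono:
  assumes "a \<in> carrier L" "b \<in> carrier L" "a \<sqsubseteq> b"
  shows "upper_star L a \<sqsubseteq> upper_star L b"
  by (metis assms le_refl le_trans star_closed star_galois)

lemma lower_star_mono:
  assumes "a \<in> carrier L" "b \<in> carrier L" "a \<sqsubseteq> b"
  shows "lower_star L a \<sqsubseteq> lower_star L b"
  by (metis assms le_refl le_trans star_closed star_galois)

text \<open>The usual triple identity of a Galois connection. It makes every
  \<open>lower_star L a\<close> the bottom of a block.\<close>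

lemma lower_upper_lower_star:
  assumes "a \<in> carrier L"
  shows "lower_star L (upper_star L (lower_star L a)) = lower_star L a"
proof (rule le_antisym)
  show "lower_star L a \<sqsubseteq> lower_star L (upper_star L (lower_star L a))"
    by (rule lower_star_mono) (simp_all add: assms star_galois)
  show "lower_star L (upper_star L (lower_star L a)) \<sqsubseteq> lower_star L a"
    by (simp add: assms flip: star_galois)
qed (simp_all add: assms)

end


section \<open>Sublattices and intervals\<close>

context lattice
begin

text \<open>A join or meet of \<open>L\<close> that stays in \<open>A\<close> is also a least or
  greatest bound inside \<open>A\<close>. The operations of the smaller record are choices of such
  bounds, so uniqueness identifies them.\<close>

lemma sublattice:
  assumes A: "A \<subseteq> carrier L"
    and join: "\<And>x y. \<lbrakk>x \<in> A; y \<in> A\<rbrakk> \<Longrightarrow> x \<squnion> y \<in> A"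
    and meet: "\<And>x y. \<lbrakk>x \<in> A; y \<in> A\<rbrakk> \<Longrightarrow> x \<sqinter> y \<in> A"
  shows "lattice (L\<lparr>carrier := A\<rparr>)"
    and "\<And>x y. \<lbrakk>x \<in> A; y \<in> A\<rbrakk> \<Longrightarrow> x \<squnion>\<^bsub>L\<lparr>carrier := A\<rparr>\<^esub> y = x \<squnion> y"
    and "\<And>x y. \<lbrakk>x \<in> A; y \<in> A\<rbrakk> \<Longrightarrow> x \<sqinter>\<^bsub>L\<lparr>carrier := A\<rparr>\<^esub> y = x \<sqinter> y"
proof -
  let ?A = "L\<lparr>carrier := A\<rparr>"
  interpret A: weak_partial_order ?A
    by (rule weak_partial_order_subset) (use A weak_partial_order_axioms in auto)
  have lub: "least ?A (x \<squnion> y) (Upper ?A {x, y})" if "x \<in> A" "y \<in> A" for x y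
    by (rule least_UpperI)
      (use that A join in \<open>auto simp: Upper_def intro!: join_le intro: join_left join_right\<close>)
  have glb: "greatest ?A (x \<sqinter> y) (Lower ?A {x, y})" if "x \<in> A" "y \<in> A" for x y
    by (rule greatest_LowerI)
      (use that A meet in \<open>auto simp: Lower_def intro!: meet_le intro: meet_left meet_right\<close>)
  show A': "lattice ?A"
  proof unfold_locales
    show "(.=\<^bsub>?A\<^esub>) = (=)" by (simp add: eq_is_equal)
  qed (simp; blast intro: lub glb)+
  then interpret A: lattice ?A .
  fix x y assume xy: "x \<in> A" "y \<in> A"
  show "x \<squnion>\<^bsub>?A\<^esub> y = x \<squnion> y"
    unfolding join_def[of ?A] using xy
    by (intro A.least_unique[OF A.sup_of_two_least]) (auto intro: lub)
  show "x \<sqinter>\<^bsub>?A\<^esub> y = x \<sqinter> y"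
    unfolding meet_def[of ?A] using xy
    by (intro A.greatest_unique[OF A.inf_of_two_greatest]) (auto intro: glb)
qed

lemma interval_closed:
  assumes "a \<in> carrier L" "b \<in> carrier L" "x \<in> \<lbrace>a..b\<rbrace>" "y \<in> \<lbrace>a..b\<rbrace>"
  shows "x \<squnion> y \<in> \<lbrace>a..b\<rbrace>" "x \<sqinter> y \<in> \<lbrace>a..b\<rbrace>"
proof -
  have x: "x \<in> carrier L" "a \<sqsubseteq> x" "x \<sqsubseteq> b" and y: "y \<in> carrier L" "a \<sqsubseteq> y" "y \<sqsubseteq> b"
    using assms by (auto simp: at_least_at_most_def)
  have "a \<sqsubseteq> x \<squnion> y" by (rule le_trans[OF x(2) join_left]) (simp_all add: assms x y)
  moreover have "x \<squnion> y \<sqsubseteq> b" by (rule join_le) (simp_all add: assms x y)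
  ultimately show "x \<squnion> y \<in> \<lbrace>a..b\<rbrace>" by (simp add: at_least_at_most_def x y)
  have "x \<sqinter> y \<sqsubseteq> b" by (rule le_trans[OF meet_left x(3)]) (simp_all add: assms x y)
  moreover have "a \<sqsubseteq> x \<sqinter> y" by (rule meet_le) (simp_all add: assms x y)
  ultimately show "x \<sqinter> y \<in> \<lbrace>a..b\<rbrace>" by (simp add: at_least_at_most_def x y)
qed

lemma interval_sublattice:
  assumes "a \<in> carrier L" "b \<in> carrier L"
  shows "lattice (L\<lparr>carrier := \<lbrace>a..b\<rbrace>\<rparr>)"
    and "\<And>x y. \<lbrakk>x \<in> \<lbrace>a..b\<rbrace>; y \<in> \<lbrace>a..b\<rbrace>\<rbrakk> \<Longrightarrow> x \<squnion>\<^bsub>L\<lparr>carrier := \<lbrace>a..b\<rbrace>\<rparr>\<^esub> y = x \<squnion> y"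
    and "\<And>x y. \<lbrakk>x \<in> \<lbrace>a..b\<rbrace>; y \<in> \<lbrace>a..b\<rbrace>\<rbrakk> \<Longrightarrow> x \<sqinter>\<^bsub>L\<lparr>carrier := \<lbrace>a..b\<rbrace>\<rparr>\<^esub> y = x \<sqinter> y"
  by (rule sublattice; use assms in \<open>simp add: at_least_at_most_closed interval_closed\<close>)+

lemma interval_least:
  "\<lbrakk>a \<in> carrier L; b \<in> carrier L; a \<sqsubseteq> b\<rbrakk> \<Longrightarrow> least (L\<lparr>carrier := \<lbrace>a..b\<rbrace>\<rparr>) a \<lbrace>a..b\<rbrace>"
  by (auto simp: least_def at_least_at_most_def)

lemma interval_greatest:
  "\<lbrakk>a \<in> carrier L; b \<in> carrier L; a \<sqsubseteq> b\<rbrakk> \<Longrightarrow> greatest (L\<lparr>carrier := \<lbrace>a..b\<rbrace>\<rparr>) b \<lbrace>a..b\<rbrace>"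
  by (auto simp: greatest_def at_least_at_most_def)

lemma interval_bounded_lattice:
  assumes "a \<in> carrier L" "b \<in> carrier L" "a \<sqsubseteq> b"
  shows "bounded_lattice (L\<lparr>carrier := \<lbrace>a..b\<rbrace>\<rparr>)"
proof -
  interpret I: lattice "L\<lparr>carrier := \<lbrace>a..b\<rbrace>\<rparr>" by (rule interval_sublattice) (use assms in simp_all)
  show ?thesis
    by unfold_locales (use interval_least[OF assms] interval_greatest[OF assms] in auto)
qed

lemma interval_bottom:
  assumes "a \<in> carrier L" "b \<in> carrier L" "a \<sqsubseteq> b"
  shows "\<bottom>\<^bsub>L\<lparr>carrier := \<lbrace>a..b\<rbrace>\<rparr>\<^esub> = a"
proof -
  interpret I: bounded_lattice "L\<lparr>carrier := \<lbrace>a..b\<rbrace>\<rparr>" by (rule interval_bounded_lattice[OF assms])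
  show ?thesis using I.bottom_least interval_least[OF assms] by (auto intro: I.least_unique)
qed

lemma interval_top:
  assumes "a \<in> carrier L" "b \<in> carrier L" "a \<sqsubseteq> b"
  shows "\<top>\<^bsub>L\<lparr>carrier := \<lbrace>a..b\<rbrace>\<rparr>\<^esub> = b"
proof -
  interpret I: bounded_lattice "L\<lparr>carrier := \<lbrace>a..b\<rbrace>\<rparr>" by (rule interval_bounded_lattice[OF assms])
  show ?thesis using I.top_greatest interval_greatest[OF assms] by (auto intro: I.greatest_unique)
qed

lemma complemented_interval_iff:
  assumes [simp]: "a \<in> carrier L" "b \<in> carrier L" and ab: "a \<sqsubseteq> b"
  shows "complemented_lattice (L\<lparr>carrier := \<lbrace>a..b\<rbrace>\<rparr>) \<longleftrightarrow> rel_complemented L a b"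
proof -
  let ?I = "L\<lparr>carrier := \<lbrace>a..b\<rbrace>\<rparr>"
  interpret I: bounded_lattice ?I by (rule interval_bounded_lattice[OF assms])
  \<comment> \<open>Here \<open>a = x \<sqinter> y \<sqsubseteq> y \<sqsubseteq> x \<squnion> y =
    b\<close>, so complements found in \<open>L\<close> are complements in the interval.\<close>
  have mem: "y \<in> \<lbrace>a..b\<rbrace>" if "x \<in> carrier L" "y \<in> carrier L" "x \<squnion> y = b" "x \<sqinter> y = a" for x y
    using that join_right[of x y] meet_right[of x y] by (auto simp: at_least_at_most_def)
  have "complemented_lattice ?I \<longleftrightarrow>
    (\<forall>x\<in>\<lbrace>a..b\<rbrace>. \<exists>y\<in>\<lbrace>a..b\<rbrace>. x \<squnion>\<^bsub>?I\<^esub> y = b \<and> x \<sqinter>\<^bsub>?I\<^esub> y = a)"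
    using I.bounded_lattice_axioms
    by (auto simp: complemented_lattice_def complemented_lattice_axioms_def interval_top[OF assms] interval_bottom[OF assms])
  also have "\<dots> \<longleftrightarrow> (\<forall>x\<in>\<lbrace>a..b\<rbrace>. \<exists>y\<in>\<lbrace>a..b\<rbrace>. x \<squnion> y = b \<and> x \<sqinter> y = a)"
    by (simp add: interval_sublattice(2,3) cong: ball_cong bex_cong)
  also have "\<dots> \<longleftrightarrow> rel_complemented L a b"
  proof
    assume *: "\<forall>x\<in>\<lbrace>a..b\<rbrace>. \<exists>y\<in>\<lbrace>a..b\<rbrace>. x \<squnion> y = b \<and> x \<sqinter> y = a"
    have "\<exists>y\<in>carrier L. x \<squnion> y = b \<and> x \<sqinter> y = a"
      if "x \<in> carrier L" "a \<sqsubseteq> x" "x \<sqsubseteq> b" for x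
    proof -
      have "x \<in> \<lbrace>a..b\<rbrace>" using that by (simp add: at_least_at_most_def)
      then obtain y where "y \<in> \<lbrace>a..b\<rbrace>" "x \<squnion> y = b" "x \<sqinter> y = a" using * by blast
      then show ?thesis using at_least_at_most_closed by blast
    qed
    then show "rel_complemented L a b" using ab by (simp add: rel_complemented_def)
  next
    assume rc: "rel_complemented L a b"
    show "\<forall>x\<in>\<lbrace>a..b\<rbrace>. \<exists>y\<in>\<lbrace>a..b\<rbrace>. x \<squnion> y = b \<and> x \<sqinter> y = a"
    proof
      fix x assume "x \<in> \<lbrace>a..b\<rbrace>"
      then have x: "x \<in> carrier L" "a \<sqsubseteq> x" "x \<sqsubseteq> b" by (auto simp: at_least_at_most_def)
      then obtain y where "y \<in> carrier L" "x \<squnion> y = b" "x \<sqinter> y = a"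
        using rc unfolding rel_complemented_def by blast
      then show "\<exists>y\<in>\<lbrace>a..b\<rbrace>. x \<squnion> y = b \<and> x \<sqinter> y = a" using mem x(1) by blast
    qed
  qed
  finally show ?thesis .
qed

lemma complemented_interval_char:
  "complemented_interval L B \<longleftrightarrow> (\<exists>a b. rel_complemented L a b \<and> B = \<lbrace>a..b\<rbrace>)"
  unfolding complemented_interval_def
  by (metis complemented_interval_iff rel_complementedD)

lemma interval_subset_iff:
  assumes "a \<in> carrier L" "b \<in> carrier L" "c \<in> carrier L" "d \<in> carrier L" "a \<sqsubseteq> b"
  shows "\<lbrace>a..b\<rbrace> \<subseteq> \<lbrace>c..d\<rbrace> \<longleftrightarrow> c \<sqsubseteq> a \<and> b \<sqsubseteq> d"
  using assms by (auto simp: at_least_at_most_def subset_iff intro: le_trans)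

lemma interval_eq_iff:
  assumes "a \<in> carrier L" "b \<in> carrier L" "c \<in> carrier L" "d \<in> carrier L" "a \<sqsubseteq> b" "c \<sqsubseteq> d"
  shows "\<lbrace>a..b\<rbrace> = \<lbrace>c..d\<rbrace> \<longleftrightarrow> a = c \<and> b = d"
  using assms by (metis interval_subset_iff le_antisym subset_refl)

end

lemma (in modular_lattice) interval_modular:
  assumes "a \<in> carrier L" "b \<in> carrier L"
  shows "modular_lattice (L\<lparr>carrier := \<lbrace>a..b\<rbrace>\<rparr>)"
proof -
  interpret I: lattice "L\<lparr>carrier := \<lbrace>a..b\<rbrace>\<rparr>" by (rule interval_sublattice) (use assms in simp_all)
  have closed: "x \<in> \<lbrace>a..b\<rbrace> \<Longrightarrow> x \<in> carrier L" for x by (auto simp: at_least_at_most_def)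
  show ?thesis
  proof
    fix x y z
    assume "x \<in> carrier (L\<lparr>carrier := \<lbrace>a..b\<rbrace>\<rparr>)" "y \<in> carrier (L\<lparr>carrier := \<lbrace>a..b\<rbrace>\<rparr>)"
      "z \<in> carrier (L\<lparr>carrier := \<lbrace>a..b\<rbrace>\<rparr>)" "x \<sqsubseteq>\<^bsub>L\<lparr>carrier := \<lbrace>a..b\<rbrace>\<rparr>\<^esub> z"
    then show "x \<squnion>\<^bsub>L\<lparr>carrier := \<lbrace>a..b\<rbrace>\<rparr>\<^esub> (y \<sqinter>\<^bsub>L\<lparr>carrier := \<lbrace>a..b\<rbrace>\<rparr>\<^esub> z) =
        (x \<squnion>\<^bsub>L\<lparr>carrier := \<lbrace>a..b\<rbrace>\<rparr>\<^esub> y) \<sqinter>\<^bsub>L\<lparr>carrier := \<lbrace>a..b\<rbrace>\<rparr>\<^esub> z"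
      by (simp add: interval_sublattice(2,3)[OF assms] interval_closed[OF assms] closed modular_law)
  qed
qed

section \<open>Blocks\<close>

text \<open>Computed from the bottom, so that blocks with equal bottoms have equal tops by
  construction; \<open>blocks_char\<close> shows that it is the greatest element of a block.\<close>

definition block_top :: "('a, 'm) gorder_scheme \<Rightarrow> 'a set \<Rightarrow> 'a"
  where "block_top L B = upper_star L (block_bot L B)"

context lffc_modular_lattice
begin

lemma block_bot_interval [simp]:
  "\<lbrakk>a \<in> carrier L; b \<in> carrier L; a \<sqsubseteq> b\<rbrakk> \<Longrightarrow> block_bot L \<lbrace>a..b\<rbrace> = a"
  by (simp add: block_bot_def interval_bottom)

text \<open>Maximality against the complemented intervals \<open>[a, upper_star L a]\<close> and
  \<open>[lower_star L b, b]\<close> gives the two equations. Conversely, the Galois connection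
  confines both ends of any larger complemented interval.\<close>

lemma blocks_char:
  assumes [simp]: "a \<in> carrier L" "b \<in> carrier L" and ab [simp]: "a \<sqsubseteq> b"
  shows "\<lbrace>a..b\<rbrace> \<in> blocks L \<longleftrightarrow> upper_star L a = b \<and> lower_star L b = a"
proof
  assume B: "\<lbrace>a..b\<rbrace> \<in> blocks L"
  then have max: "\<lbrace>c..d\<rbrace> = \<lbrace>a..b\<rbrace>" if "rel_complemented L c d" "\<lbrace>a..b\<rbrace> \<subseteq> \<lbrace>c..d\<rbrace>" for c d
    using that by (auto simp: blocks_def complemented_interval_char)
  obtain c d where cd: "rel_complemented L c d" "\<lbrace>a..b\<rbrace> = \<lbrace>c..d\<rbrace>"
    using B by (auto simp: blocks_def complemented_interval_char)
  then have rc: "rel_complemented L a b"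
    using rel_complementedD[OF cd(1)] by (auto simp: interval_eq_iff)
  have "\<lbrace>a..upper_star L a\<rbrace> = \<lbrace>a..b\<rbrace>" "\<lbrace>lower_star L b..b\<rbrace> = \<lbrace>a..b\<rbrace>"
    by (intro max; simp add: interval_subset_iff rel_complemented_upper_star
        rel_complemented_lower_star le_upper_star lower_star_le rc)+
  then show "upper_star L a = b \<and> lower_star L b = a" by (simp add: interval_eq_iff)
next
  assume eq: "upper_star L a = b \<and> lower_star L b = a"
  then have rc: "rel_complemented L a b" using rel_complemented_upper_star[of a] by simp
  have "\<lbrace>c..d\<rbrace> = \<lbrace>a..b\<rbrace>" if cd: "rel_complemented L c d" and sub: "\<lbrace>a..b\<rbrace> \<subseteq> \<lbrace>c..d\<rbrace>" for c d
  proof -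
    note [simp] = rel_complementedD[OF cd]
    have ca: "c \<sqsubseteq> a" and bd: "b \<sqsubseteq> d" using sub by (auto simp: interval_subset_iff)
    have dc: "d \<sqsubseteq> upper_star L c" "lower_star L d \<sqsubseteq> c" by (auto intro: le_upper_star lower_star_le cd)
    \<comment> \<open>From \<open>b \<sqsubseteq> d \<sqsubseteq> upper_star L c\<close> the Galois
      connection yields \<open>a = lower_star L b \<sqsubseteq> c\<close>; the upper end is
      dual.\<close>
    have "a \<sqsubseteq> c" using le_trans[OF bd dc(1)] eq by (simp add: star_galois)
    then have "c = a" using ca by (intro le_antisym) simp_all
    have "d \<sqsubseteq> b" using le_trans[OF dc(2) ca] eq by (simp flip: star_galois)
    then have "d = b" using bd by (intro le_antisym) simp_all
    with \<open>c = a\<close> show ?thesis by simp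
  qed
  then show "\<lbrace>a..b\<rbrace> \<in> blocks L" using rc unfolding blocks_def complemented_interval_char by blast
qed

lemma block:
  assumes "B \<in> blocks L"
  shows "block_bot L B \<in> carrier L" "block_top L B \<in> carrier L" "block_bot L B \<sqsubseteq> block_top L B"
    and "B = \<lbrace>block_bot L B..block_top L B\<rbrace>"
    and "lower_star L (block_top L B) = block_bot L B"
    and "upper_star L (block_bot L B) = block_top L B"
proof -
  obtain a b where rc: "rel_complemented L a b" and B: "B = \<lbrace>a..b\<rbrace>"
    using assms by (auto simp: blocks_def complemented_interval_char)
  note [simp] = rel_complementedD[OF rc]
  have eq: "upper_star L a = b" "lower_star L b = a" using iffD1[OF blocks_char[of a b]] assms B by simp_all
  have bb: "block_bot L B = a" "block_top L B = b" by (simp_all add: B eq block_top_def)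
  show "block_bot L B \<in> carrier L" "block_top L B \<in> carrier L" "block_bot L B \<sqsubseteq> block_top L B"
    "B = \<lbrace>block_bot L B..block_top L B\<rbrace>" "lower_star L (block_top L B) = block_bot L B"
    "upper_star L (block_bot L B) = block_top L B"
    unfolding bb using B eq by simp_all
qed

lemma mem_block_iff:
  "B \<in> blocks L \<Longrightarrow> x \<in> B \<longleftrightarrow> x \<in> carrier L \<and> block_bot L B \<sqsubseteq> x \<and> x \<sqsubseteq> block_top L B"
  using block(4)[of B] by (auto simp: at_least_at_most_def)

lemma block_eqI:
  "\<lbrakk>B \<in> blocks L; C \<in> blocks L; block_bot L B = block_bot L C\<rbrakk> \<Longrightarrow> B = C"
  by (metis block(4) block_top_def)

text \<open>Both stars are monotone, and between bottoms and tops of blocks they are inverse to each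
  other.\<close>

lemma block_top_le_iff:
  "\<lbrakk>B \<in> blocks L; C \<in> blocks L\<rbrakk> \<Longrightarrow>
    block_top L B \<sqsubseteq> block_top L C \<longleftrightarrow> block_bot L B \<sqsubseteq> block_bot L C"
  by (metis block(1,2,5,6) upper_star_mono lower_star_mono)

lemma block_of_bot:
  assumes "a \<in> carrier L" "lower_star L (upper_star L a) = a"
  obtains B where "B \<in> blocks L" "block_bot L B = a" "block_top L B = upper_star L a"
  using assms blocks_char[of a "upper_star L a"] block_bot_interval[of a "upper_star L a"]
  by (auto simp: block_top_def)

lemma block_of_top:
  assumes "b \<in> carrier L" "upper_star L (lower_star L b) = b"
  obtains B where "B \<in> blocks L" "block_top L B = b" "block_bot L B = lower_star L b"
  by (rule block_of_bot[of "lower_star L b"]) (use assms in auto)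

text \<open>The map sending \<open>a\<close> to \<open>lower_star L (upper_star L a)\<close> is an
  interior operator, and its fixed points, the bottoms of blocks, are closed under joins.\<close>

lemma block_join:
  assumes B: "B \<in> blocks L" and C: "C \<in> blocks L"
  obtains E where "E \<in> blocks L" "block_bot L E = block_bot L B \<squnion> block_bot L C"
proof -
  note [simp] = block(1,2)[OF B] block(1,2)[OF C]
  let ?a = "block_bot L B \<squnion> block_bot L C"
  have "lower_star L (upper_star L (block_bot L B)) \<sqsubseteq> lower_star L (upper_star L ?a)"
    by (intro lower_star_mono upper_star_mono) (simp_all add: join_left)
  moreover have "lower_star L (upper_star L (block_bot L C)) \<sqsubseteq> lower_star L (upper_star L ?a)"
    by (intro lower_star_mono upper_star_mono) (simp_all add: join_right)
  ultimately have "?a \<sqsubseteq> lower_star L (upper_star L ?a)"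
    by (intro join_le) (simp_all add: block(5,6)[OF B] block(5,6)[OF C])
  then have "lower_star L (upper_star L ?a) = ?a" by (intro le_antisym) (simp_all flip: star_galois)
  then show ?thesis by (rule block_of_bot[rotated]) (auto intro: that)
qed

text \<open>Dually, the composite of the stars in the other order is a closure operator, and its
  fixed points, the tops of blocks, are closed under meets.\<close>

lemma block_meet:
  assumes B: "B \<in> blocks L" and C: "C \<in> blocks L"
  obtains E where "E \<in> blocks L" "block_top L E = block_top L B \<sqinter> block_top L C"
proof -
  note [simp] = block(1,2)[OF B] block(1,2)[OF C]
  let ?b = "block_top L B \<sqinter> block_top L C"
  have "upper_star L (lower_star L ?b) \<sqsubseteq> upper_star L (lower_star L (block_top L B))"
    by (intro lower_star_mono upper_star_mono) (simp_all add: meet_left)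
  moreover have "upper_star L (lower_star L ?b) \<sqsubseteq> upper_star L (lower_star L (block_top L C))"
    by (intro lower_star_mono upper_star_mono) (simp_all add: meet_right)
  ultimately have "upper_star L (lower_star L ?b) \<sqsubseteq> ?b"
    by (intro meet_le) (simp_all add: block(5,6)[OF B] block(5,6)[OF C])
  then have "upper_star L (lower_star L ?b) = ?b" by (intro le_antisym) (simp_all add: star_galois)
  then show ?thesis by (rule block_of_top[rotated]) (auto intro: that)
qed

section \<open>The skeleton and the dissection tolerance\<close>

lemma carrier_skeleton [simp]: "carrier (skeleton L) = blocks L"
  and eq_skeleton [simp]: "(.=\<^bsub>skeleton L\<^esub>) = (=)"
  and le_skeleton [simp]: "B \<sqsubseteq>\<^bsub>skeleton L\<^esub> C \<longleftrightarrow> block_bot L B \<sqsubseteq> block_bot L C"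
  by (simp_all add: skeleton_def)

text \<open>Joins are found through bottoms and meets through tops; \<open>block_top_le_iff\<close>
  allows the order to be read at either end.\<close>

lemma lattice_skeleton: "lattice (skeleton L)"
proof -
  interpret S: partial_order "skeleton L"
    by unfold_locales
      (simp_all add: block(1), metis block(1) block_eqI le_antisym, metis block(1) le_trans)
  have "\<exists>E. least (skeleton L) E (Upper (skeleton L) {B, C})"
    if B: "B \<in> blocks L" and C: "C \<in> blocks L" for B C
  proof -
    obtain E where E: "E \<in> blocks L" "block_bot L E = block_bot L B \<squnion> block_bot L C"
      using block_join[OF B C] .
    have "least (skeleton L) E (Upper (skeleton L) {B, C})"
    proof (rule least_UpperI)
      show "X \<sqsubseteq>\<^bsub>skeleton L\<^esub> E" if "X \<in> {B, C}" for X
        using that B C E by (auto simp: block(1) join_left join_right)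
      show "E \<sqsubseteq>\<^bsub>skeleton L\<^esub> X" if "X \<in> Upper (skeleton L) {B, C}" for X
        using that B C E by (simp add: Upper_def block(1) join_le)
    qed (use B C E in simp_all)
    then show ?thesis ..
  qed
  moreover have "\<exists>E. greatest (skeleton L) E (Lower (skeleton L) {B, C})"
    if B: "B \<in> blocks L" and C: "C \<in> blocks L" for B C
  proof -
    obtain E where E: "E \<in> blocks L" "block_top L E = block_top L B \<sqinter> block_top L C"
      using block_meet[OF B C] .
    have "greatest (skeleton L) E (Lower (skeleton L) {B, C})"
    proof (rule greatest_LowerI)
      show "E \<sqsubseteq>\<^bsub>skeleton L\<^esub> X" if "X \<in> {B, C}" for X
        using that B C E by (auto simp: block(2) meet_left meet_right simp flip: block_top_le_iff)
      show "X \<sqsubseteq>\<^bsub>skeleton L\<^esub> E" if "X \<in> Lower (skeleton L) {B, C}" for X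
        using that B C E by (auto simp: Lower_def block(2) simp flip: block_top_le_iff intro!: meet_le)
    qed (use B C E in simp_all)
    then show ?thesis ..
  qed
  ultimately show ?thesis by unfold_locales auto
qed

sublocale S: lattice "skeleton L" by (rule lattice_skeleton)

lemma block_bot_join:
  assumes B: "B \<in> blocks L" and C: "C \<in> blocks L"
  shows "block_bot L (B \<squnion>\<^bsub>skeleton L\<^esub> C) = block_bot L B \<squnion> block_bot L C"
proof -
  obtain E where E: "E \<in> blocks L" "block_bot L E = block_bot L B \<squnion> block_bot L C"
    using block_join[OF B C] .
  have J: "B \<squnion>\<^bsub>skeleton L\<^esub> C \<in> blocks L" using S.join_closed B C by simp
  have "B \<squnion>\<^bsub>skeleton L\<^esub> C \<sqsubseteq>\<^bsub>skeleton L\<^esub> E"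
    by (rule S.join_le) (use B C E in \<open>auto simp: block(1) intro: join_left join_right\<close>)
  moreover have "block_bot L B \<squnion> block_bot L C \<sqsubseteq> block_bot L (B \<squnion>\<^bsub>skeleton L\<^esub> C)"
    using S.join_left[of B C] S.join_right[of B C] B C J by (intro join_le) (auto simp: block(1))
  ultimately show ?thesis using B C E J by (intro le_antisym) (auto simp: block(1))
qed

lemma block_top_meet:
  assumes B: "B \<in> blocks L" and C: "C \<in> blocks L"
  shows "block_top L (B \<sqinter>\<^bsub>skeleton L\<^esub> C) = block_top L B \<sqinter> block_top L C"
proof -
  obtain E where E: "E \<in> blocks L" "block_top L E = block_top L B \<sqinter> block_top L C"
    using block_meet[OF B C] .
  have J: "B \<sqinter>\<^bsub>skeleton L\<^esub> C \<in> blocks L" using S.meet_closed B C by simp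
  have "E \<sqsubseteq>\<^bsub>skeleton L\<^esub> B \<sqinter>\<^bsub>skeleton L\<^esub> C"
    by (rule S.meet_le)
      (use B C E in \<open>auto simp: block(2) block_top_le_iff[symmetric] intro: meet_left meet_right\<close>)
  then have "block_top L B \<sqinter> block_top L C \<sqsubseteq> block_top L (B \<sqinter>\<^bsub>skeleton L\<^esub> C)"
    using E J by (simp flip: block_top_le_iff)
  moreover have "block_top L (B \<sqinter>\<^bsub>skeleton L\<^esub> C) \<sqsubseteq> block_top L B \<sqinter> block_top L C"
    using S.meet_left[of B C] S.meet_right[of B C] B C J
    by (intro meet_le) (auto simp: block(2) block_top_le_iff)
  ultimately show ?thesis using B C J by (intro le_antisym) (auto simp: block(2))
qed

lemma tolerance_iff:
  "(B, C) \<in> dissection_tolerance L \<longleftrightarrow> B \<in> blocks L \<and> C \<in> blocks L \<and>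
    block_bot L B \<sqsubseteq> block_top L C \<and> block_bot L C \<sqsubseteq> block_top L B"
proof (cases "B \<in> blocks L \<and> C \<in> blocks L")
  case True
  then have B: "B \<in> blocks L" and C: "C \<in> blocks L" by auto
  note [simp] = block(1-3)[OF B] block(1-3)[OF C]
  have "block_bot L B \<sqsubseteq> block_top L C \<and> block_bot L C \<sqsubseteq> block_top L B" if "x \<in> B" "x \<in> C" for x
    using that by (auto simp: mem_block_iff B C intro: le_trans[of _ x])
  \<comment> \<open>Every common element lies above both bottoms, so their join is the smallest
    candidate.\<close>
  moreover have "block_bot L B \<squnion> block_bot L C \<in> B \<inter> C"
    if "block_bot L B \<sqsubseteq> block_top L C" "block_bot L C \<sqsubseteq> block_top L B"
    using that by (auto simp: mem_block_iff B C intro: join_left join_right join_le)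
  ultimately show ?thesis using B C by (auto simp: dissection_tolerance_def)
qed (auto simp: dissection_tolerance_def)

lemma tol_le_iff:
  assumes "B \<in> blocks L" "C \<in> blocks L"
  shows "tol_le (skeleton L) (dissection_tolerance L) B C \<longleftrightarrow>
    block_bot L B \<sqsubseteq> block_bot L C \<and> block_bot L C \<sqsubseteq> block_top L B"
proof -
  note [simp] = block(1-3)[OF assms(1)] block(1-3)[OF assms(2)]
  have "block_bot L B \<sqsubseteq> block_top L C" if "block_bot L B \<sqsubseteq> block_bot L C"
    by (rule le_trans[OF that]) simp_all
  then show ?thesis using assms by (auto simp: tol_le_def tolerance_iff)
qed

text \<open>By \<open>tolerance_iff\<close> only bottoms and tops have to be compared. The bottom of
  a join is the join of the bottoms, while its top lies above both tops; meets are dual.\<close>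

lemma lattice_tolerance_dissection: "lattice_tolerance (skeleton L) (dissection_tolerance L)"
proof
  show "dissection_tolerance L \<subseteq> carrier (skeleton L) \<times> carrier (skeleton L)"
    by (auto simp: dissection_tolerance_def)
  show "refl_on (carrier (skeleton L)) (dissection_tolerance L)"
    by (auto simp: refl_on_def tolerance_iff block)
  show "sym (dissection_tolerance L)" by (auto simp: sym_def tolerance_iff)
  fix A B C D
  assume AB: "(A, B) \<in> dissection_tolerance L" and CD: "(C, D) \<in> dissection_tolerance L"
  then have blk [simp]: "A \<in> blocks L" "B \<in> blocks L" "C \<in> blocks L" "D \<in> blocks L"
    by (auto simp: tolerance_iff)
  have jm [simp]: "X \<squnion>\<^bsub>skeleton L\<^esub> Y \<in> blocks L" "X \<sqinter>\<^bsub>skeleton L\<^esub> Y \<in> blocks L"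
    if "X \<in> blocks L" "Y \<in> blocks L" for X Y
    using that S.join_closed S.meet_closed by simp_all
  note [simp] = block(1,2)
  have join: "block_bot L (X \<squnion>\<^bsub>skeleton L\<^esub> Y) \<sqsubseteq> block_top L (X' \<squnion>\<^bsub>skeleton L\<^esub> Y')"
    if X [simp]: "X \<in> blocks L" "Y \<in> blocks L" "X' \<in> blocks L" "Y' \<in> blocks L"
      and le: "block_bot L X \<sqsubseteq> block_top L X'" "block_bot L Y \<sqsubseteq> block_top L Y'" for X Y X' Y'
  proof -
    have "block_top L X' \<sqsubseteq> block_top L (X' \<squnion>\<^bsub>skeleton L\<^esub> Y')"
      "block_top L Y' \<sqsubseteq> block_top L (X' \<squnion>\<^bsub>skeleton L\<^esub> Y')"
      by (simp_all add: block_top_le_iff block_bot_join join_left join_right)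
    then show ?thesis
      unfolding block_bot_join[OF X(1,2)] by (intro join_le) (auto intro: le_trans[OF le(1)] le_trans[OF le(2)])
  qed
  have meet: "block_bot L (X \<sqinter>\<^bsub>skeleton L\<^esub> Y) \<sqsubseteq> block_top L (X' \<sqinter>\<^bsub>skeleton L\<^esub> Y')"
    if X [simp]: "X \<in> blocks L" "Y \<in> blocks L" "X' \<in> blocks L" "Y' \<in> blocks L"
      and le: "block_bot L X \<sqsubseteq> block_top L X'" "block_bot L Y \<sqsubseteq> block_top L Y'" for X Y X' Y'
  proof -
    have "block_bot L (X \<sqinter>\<^bsub>skeleton L\<^esub> Y) \<sqsubseteq> block_bot L X"
      "block_bot L (X \<sqinter>\<^bsub>skeleton L\<^esub> Y) \<sqsubseteq> block_bot L Y"
      by (simp_all add: block_top_meet meet_left meet_right flip: block_top_le_iff)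
    then show ?thesis
      unfolding block_top_meet[OF X(3,4)]
      by (intro meet_le) (auto intro: le_trans[OF _ le(1)] le_trans[OF _ le(2)])
  qed
  show "(A \<squnion>\<^bsub>skeleton L\<^esub> C, B \<squnion>\<^bsub>skeleton L\<^esub> D) \<in> dissection_tolerance L"
    using AB CD join[of A C B D] join[of B D A C] by (simp add: tolerance_iff)
  show "(A \<sqinter>\<^bsub>skeleton L\<^esub> C, B \<sqinter>\<^bsub>skeleton L\<^esub> D) \<in> dissection_tolerance L"
    using AB CD meet[of A C B D] meet[of B D A C] by (simp add: tolerance_iff)
qed

section \<open>Covers in the skeleton and its finiteness\<close>

lemma skeleton_cover_tolerance:
  assumes cov: "B \<lessdot>\<^bsub>skeleton L\<^esub> C"
  shows "(B, C) \<in> dissection_tolerance L"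
proof -
  have B: "B \<in> blocks L" and C: "C \<in> blocks L" and le: "block_bot L B \<sqsubseteq> block_bot L C" and ne: "B \<noteq> C"
    and between: "\<And>D. \<lbrakk>D \<in> blocks L; block_bot L B \<sqsubseteq> block_bot L D; block_bot L D \<sqsubseteq> block_bot L C\<rbrakk>
      \<Longrightarrow> D = B \<or> D = C"
    using cov by (auto simp: covered_by_def S.lless_eq)
  note [simp] = block(1-3)[OF B] block(1-3)[OF C]
  \<comment> \<open>Equal tops would have equal lower stars, hence equal bottoms.\<close>
  have "block_top L B \<sqsubset> block_top L C"
    using le ne B C block_eqI[OF B C] block(5)[OF B] block(5)[OF C]
    by (auto simp: lless_eq block_top_le_iff)
  then obtain q where q: "block_top L B \<lessdot> q" "q \<sqsubseteq> block_top L C"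
    by (rule exists_upper_cover[rotated 2]) auto
  then have [simp]: "q \<in> carrier L" and Bq: "block_top L B \<sqsubset> q" by (auto simp: covered_by_def)
  \<comment> \<open>By the triple identity \<open>lower_star L q\<close> is the bottom of a block;
    this block lies between \<open>B\<close> and \<open>C\<close>, so it is one of them.\<close>
  obtain D where D: "D \<in> blocks L" "block_bot L D = lower_star L q"
    using block_of_bot[of "lower_star L q"] lower_upper_lower_star[of q] by auto
  have "lower_star L (block_top L B) \<sqsubseteq> lower_star L q" "lower_star L q \<sqsubseteq> lower_star L (block_top L C)"
    using q Bq by (auto intro!: lower_star_mono simp: lless_eq)
  then have "D = B \<or> D = C" using D by (intro between) (simp_all add: block(5)[OF B] block(5)[OF C])
  \<comment> \<open>Otherwise \<open>lower_star L q\<close> would be \<open>0\<^sub>B\<close>, and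
    the Galois connection would put \<open>q\<close> below \<open>1\<^sub>B\<close>.\<close>
  moreover have "D \<noteq> B"
  proof
    assume "D = B"
    then have "q \<sqsubseteq> block_top L B" using D block(6)[OF B] star_galois[of "block_bot L B" q] by simp
    with Bq show False by (auto simp: lless_eq)
  qed
  ultimately have bC: "block_bot L C = lower_star L q" using D by auto
  have "lower_star L q \<sqsubseteq> block_top L B"
    using q(1) by (rule lower_star_le_lower_cover)
  with bC have "block_bot L C \<sqsubseteq> block_top L B" by simp
  moreover have "block_bot L B \<sqsubseteq> block_top L C" by (rule le_trans[OF le]) simp_all
  ultimately show ?thesis using B C by (simp add: tolerance_iff)
qed

lemma blocks_nonempty:
  assumes "carrier L \<noteq> {}"
  shows "blocks L \<noteq> {}"
proof -
  obtain x where "x \<in> carrier L" using assms by blast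
  then have "lower_star L x \<in> carrier L"
    "lower_star L (upper_star L (lower_star L x)) = lower_star L x"
    by (simp_all add: lower_upper_lower_star)
  then show ?thesis by (rule block_of_bot) blast
qed

lemma finite_block: "B \<in> blocks L \<Longrightarrow> finite B"
  by (metis block(1,2,4) finite_interval)

text \<open>Bottoms embed an interval of the skeleton into an interval of \<open>L\<close>. For
  covers of \<open>B\<close> the tolerance helps: bottoms of upper covers and tops of lower covers
  lie in the finite set \<open>B\<close>.\<close>

lemma lffc_skeleton: "lffc (skeleton L)"
  unfolding lffc_def locally_finite_def has_finite_covers_def carrier_skeleton
proof (intro conjI ballI)
  fix A B assume A: "A \<in> blocks L" and B: "B \<in> blocks L"
  have "block_bot L ` \<lbrace>A..B\<rbrace>\<^bsub>skeleton L\<^esub> \<subseteq> \<lbrace>block_bot L A..block_bot L B\<rbrace>"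
    by (auto simp: at_least_at_most_def block(1))
  then have "finite (block_bot L ` \<lbrace>A..B\<rbrace>\<^bsub>skeleton L\<^esub>)"
    by (rule finite_subset) (simp add: finite_interval A B block(1))
  moreover have "inj_on (block_bot L) \<lbrace>A..B\<rbrace>\<^bsub>skeleton L\<^esub>"
    by (rule inj_onI, rule block_eqI) (auto simp: at_least_at_most_def)
  ultimately show "finite \<lbrace>A..B\<rbrace>\<^bsub>skeleton L\<^esub>" by (rule finite_imageD)
next
  fix B assume B: "B \<in> blocks L"
  have "block_bot L C \<in> B" if "B \<lessdot>\<^bsub>skeleton L\<^esub> C" for C
    using skeleton_cover_tolerance[OF that] that
    by (auto simp: tolerance_iff mem_block_iff block(1) covered_by_def S.lless_eq)
  then have "block_bot L ` {C. B \<lessdot>\<^bsub>skeleton L\<^esub> C} \<subseteq> B" by blast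
  then have "finite (block_bot L ` {C. B \<lessdot>\<^bsub>skeleton L\<^esub> C})"
    using finite_block[OF B] by (rule finite_subset)
  moreover have "inj_on (block_bot L) {C. B \<lessdot>\<^bsub>skeleton L\<^esub> C}"
    by (rule inj_onI, rule block_eqI) (auto simp: covered_by_def)
  ultimately show "finite {C. B \<lessdot>\<^bsub>skeleton L\<^esub> C}" by (rule finite_imageD)
  have "block_top L C \<in> B" if "C \<lessdot>\<^bsub>skeleton L\<^esub> B" for C
    using skeleton_cover_tolerance[OF that] that
    by (auto simp: tolerance_iff mem_block_iff block(2) block_top_le_iff covered_by_def S.lless_eq)
  then have "block_top L ` {C. C \<lessdot>\<^bsub>skeleton L\<^esub> B} \<subseteq> B" by blast
  then have "finite (block_top L ` {C. C \<lessdot>\<^bsub>skeleton L\<^esub> B})"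
    using finite_block[OF B] by (rule finite_subset)
  \<comment> \<open>Tops determine bottoms through \<open>lower_star\<close>.\<close>
  moreover have "inj_on (block_top L) {C. C \<lessdot>\<^bsub>skeleton L\<^esub> B}"
    by (rule inj_onI, rule block_eqI, auto simp: covered_by_def, metis block(5))
  ultimately show "finite {C. C \<lessdot>\<^bsub>skeleton L\<^esub> B}" by (rule finite_imageD)
qed

section \<open>Intersections of blocks as connections\<close>

lemma block_inter:
  assumes "B \<in> blocks L" "C \<in> blocks L" "block_bot L B \<sqsubseteq> block_bot L C"
  shows "B \<inter> C = \<lbrace>block_bot L C..block_top L B\<rbrace>"
proof -
  note [simp] = block(1-3)[OF assms(1)] block(1-3)[OF assms(2)]
  have le: "block_top L B \<sqsubseteq> block_top L C" using assms by (simp add: block_top_le_iff)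
  have "block_bot L B \<sqsubseteq> x" if "x \<in> carrier L" "block_bot L C \<sqsubseteq> x" for x
    by (rule le_trans[OF assms(3) that(2)]) (simp_all add: that)
  moreover have "x \<sqsubseteq> block_top L C" if "x \<in> carrier L" "x \<sqsubseteq> block_top L B" for x
    by (rule le_trans[OF that(2) le]) (simp_all add: that)
  ultimately show ?thesis
    by (auto simp: mem_block_iff assms(1,2) at_least_at_most_def)
qed

lemma block_sublattice:
  assumes "B \<in> blocks L"
  shows "lattice (L\<lparr>carrier := B\<rparr>)"
    and "\<And>x y. \<lbrakk>x \<in> B; y \<in> B\<rbrakk> \<Longrightarrow> x \<squnion>\<^bsub>L\<lparr>carrier := B\<rparr>\<^esub> y = x \<squnion> y"
    and "\<And>x y. \<lbrakk>x \<in> B; y \<in> B\<rbrakk> \<Longrightarrow> x \<sqinter>\<^bsub>L\<lparr>carrier := B\<rparr>\<^esub> y = x \<sqinter> y"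
  using interval_sublattice[OF block(1,2)[OF assms]] block(4)[OF assms] by simp_all

text \<open>The intersection is \<open>[0\<^sub>C, 1\<^sub>B]\<close>: the part of \<open>B\<close>
  above \<open>0\<^sub>C\<close> and at the same time the part of \<open>C\<close> below
  \<open>1\<^sub>B\<close>.\<close>

lemma block_connection:
  assumes B: "B \<in> blocks L" and C: "C \<in> blocks L"
    and le: "block_bot L B \<sqsubseteq> block_bot L C" "block_bot L C \<sqsubseteq> block_top L B"
  shows "B \<inter> C \<noteq> {}" "lattice_filter (L\<lparr>carrier := B\<rparr>) (B \<inter> C)"
    "lattice_ideal (L\<lparr>carrier := C\<rparr>) (B \<inter> C)"
    "lattice_iso (L\<lparr>carrier := B \<inter> C\<rparr>) (L\<lparr>carrier := B \<inter> C\<rparr>) id"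
proof -
  note [simp] = block(1-3)[OF B] block(1-3)[OF C]
  note eq = block_inter[OF B C le(1)]
  have closed: "x \<squnion> y \<in> B \<inter> C" "x \<sqinter> y \<in> B \<inter> C" if "x \<in> B \<inter> C" "y \<in> B \<inter> C" for x y
    using that interval_closed[of "block_bot L C" "block_top L B" x y] by (simp_all add: eq)
  have up: "z \<in> B \<inter> C" if "x \<in> B \<inter> C" "z \<in> B" "x \<sqsubseteq> z" for x z
    using that le_trans[of "block_bot L C" x z] unfolding eq
    by (auto simp: at_least_at_most_def mem_block_iff B)
  have down: "z \<in> B \<inter> C" if "x \<in> B \<inter> C" "z \<in> C" "z \<sqsubseteq> x" for x z
    using that le_trans[of z x "block_top L B"] unfolding eq
    by (auto simp: at_least_at_most_def mem_block_iff C)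
  show "B \<inter> C \<noteq> {}" unfolding eq using le by (auto simp: at_least_at_most_def)
  show "lattice_filter (L\<lparr>carrier := B\<rparr>) (B \<inter> C)"
    unfolding lattice_filter_def using up closed by (auto simp: block_sublattice[OF B])
  show "lattice_ideal (L\<lparr>carrier := C\<rparr>) (B \<inter> C)"
    unfolding lattice_ideal_def using down closed by (auto simp: block_sublattice[OF C])
  \<comment> \<open>Preservation of joins and meets includes that source and target are
    lattices.\<close>
  have "lattice (L\<lparr>carrier := B \<inter> C\<rparr>)" unfolding eq by (rule interval_sublattice) simp_all
  then show "lattice_iso (L\<lparr>carrier := B \<inter> C\<rparr>) (L\<lparr>carrier := B \<inter> C\<rparr>) id"
    by (simp add: lattice_iso_def join_pres_def meet_pres_def)
qed

section \<open>Verification of the axioms of a modular connected system\<close>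

lemma modular_connected_system_blocks:
  assumes "carrier L \<noteq> {}"
  shows "modular_connected_system (skeleton L) (dissection_tolerance L)
    (\<lambda>B. L\<lparr>carrier := B\<rparr>) (\<lambda>B C. B \<inter> C) (\<lambda>B C. B \<inter> C) (\<lambda>B C. id)"
proof (intro modular_connected_system.intro lattice_tolerance_dissection
    modular_connected_system_axioms.intro)
  show "carrier (skeleton L) \<noteq> {}" using blocks_nonempty[OF assms] by simp
  show "lffc (skeleton L)" by (rule lffc_skeleton)
next
  fix B assume "B \<in> carrier (skeleton L)"
  then have B: "B \<in> blocks L" by simp
  have "complemented_lattice (L\<lparr>carrier := B\<rparr>)"
    using B by (auto simp: blocks_def complemented_interval_def)
  moreover have "modular_lattice (L\<lparr>carrier := B\<rparr>)"
    using interval_modular[OF block(1,2)[OF B]] block(4)[OF B] by simp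
  ultimately show "finite (carrier (L\<lparr>carrier := B\<rparr>)) \<and> modular_lattice (L\<lparr>carrier := B\<rparr>) \<and>
      complemented_lattice (L\<lparr>carrier := B\<rparr>)"
    using finite_block[OF B] by simp
next
  fix B C assume le: "tol_le (skeleton L) (dissection_tolerance L) B C"
  then have blk: "B \<in> blocks L" "C \<in> blocks L" by (auto simp: tol_le_def tolerance_iff)
  then show "B \<inter> C \<noteq> {} \<and> lattice_filter (L\<lparr>carrier := B\<rparr>) (B \<inter> C) \<and>
      lattice_ideal (L\<lparr>carrier := C\<rparr>) (B \<inter> C) \<and>
      lattice_iso (L\<lparr>carrier := B, carrier := B \<inter> C\<rparr>) (L\<lparr>carrier := C, carrier := B \<inter> C\<rparr>) id"
    using le block_connection[OF blk] by (simp add: tol_le_iff[OF blk])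
next
  fix B C D
  assume "tol_le (skeleton L) (dissection_tolerance L) B C"
    "tol_le (skeleton L) (dissection_tolerance L) C D" "(B \<inter> C) \<inter> (C \<inter> D) \<noteq> {}"
  \<comment> \<open>(MC5): an element common to all three blocks shows that \<open>B\<close> and
    \<open>D\<close> meet.\<close>
  then show "(B, D) \<in> dissection_tolerance L"
    by (auto simp: tol_le_def dissection_tolerance_def)
next
  fix D B C
  assume "D \<in> carrier (skeleton L)" "B \<sqsubseteq>\<^bsub>skeleton L\<^esub> D" "D \<sqsubseteq>\<^bsub>skeleton L\<^esub> C"
    and "(B, C) \<in> dissection_tolerance L"
  then have B: "B \<in> blocks L" and D: "D \<in> blocks L" and C: "C \<in> blocks L"
    and le: "block_bot L B \<sqsubseteq> block_bot L D" "block_bot L D \<sqsubseteq> block_bot L C"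
    by (auto simp: tolerance_iff)
  have le': "block_top L B \<sqsubseteq> block_top L D" using le B D by (simp add: block_top_le_iff)
  \<comment> \<open>(MC6): with identity connections everything reduces to this inclusion, which
    holds by \<open>0\<^sub>D \<sqsubseteq> 0\<^sub>C \<sqsubseteq> x \<sqsubseteq> 1\<^sub>B
    \<sqsubseteq> 1\<^sub>D\<close>.\<close>
  have "B \<inter> C \<subseteq> D"
  proof
    fix x assume "x \<in> B \<inter> C"
    then have "x \<in> carrier L" "block_bot L C \<sqsubseteq> x" "x \<sqsubseteq> block_top L B"
      using B C by (auto simp: mem_block_iff)
    then show "x \<in> D"
      using le_trans[OF le(2), of x] le_trans[OF _ le', of x] B C D by (simp add: mem_block_iff block)
  qed
  then show "B \<inter> C = {x \<in> B \<inter> D. id x \<in> (B \<inter> D) \<inter> (D \<inter> C)} \<and>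
      B \<inter> C = id ` ((B \<inter> D) \<inter> (D \<inter> C)) \<and> (\<forall>x\<in>B \<inter> C. id x = id (id x))"
    by auto
next
  fix B C assume "(B, C) \<in> dissection_tolerance L"
  then have B: "B \<in> blocks L" and C: "C \<in> blocks L" by (auto simp: tolerance_iff)
  let ?j = "B \<squnion>\<^bsub>skeleton L\<^esub> C" and ?m = "B \<sqinter>\<^bsub>skeleton L\<^esub> C"
  have j: "?j \<in> blocks L" and m: "?m \<in> blocks L" using S.join_closed S.meet_closed B C by simp_all
  note [simp] = block(1,2)[OF B] block(1,2)[OF C] block(1,2)[OF j] block(1,2)[OF m]
  \<comment> \<open>(MC7): \<open>x\<close> lies above the bottom of \<open>?j\<close>, a join of
    bottoms, and below the top of \<open>?m\<close>, a meet of tops. The other two bounds hold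
    because \<open>?m\<close> is below \<open>B\<close> and \<open>?j\<close> above it.\<close>
  have "x \<in> ?j \<and> x \<in> ?m" if "x \<in> B" "x \<in> C" for x
  proof -
    have x [simp]: "x \<in> carrier L" and bot: "block_bot L B \<sqsubseteq> x" "block_bot L C \<sqsubseteq> x"
      and top: "x \<sqsubseteq> block_top L B" "x \<sqsubseteq> block_top L C"
      using that B C by (auto simp: mem_block_iff)
    have "block_bot L ?j \<sqsubseteq> x" using bot by (simp add: block_bot_join B C join_le)
    moreover have "x \<sqsubseteq> block_top L ?m" using top by (simp add: block_top_meet B C meet_le)
    moreover have "block_bot L ?m \<sqsubseteq> block_bot L B" "block_bot L B \<sqsubseteq> block_bot L ?j"
      using S.meet_left[of B C] S.join_left[of B C] B C by simp_all
    moreover from this have "block_top L B \<sqsubseteq> block_top L ?j" using B j by (simp add: block_top_le_iff)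
    ultimately show ?thesis
      using j m le_trans[of "block_bot L ?m" "block_bot L B" x] le_trans[of x "block_top L B" "block_top L ?j"]
        bot top
      by (simp add: mem_block_iff)
  qed
  then show "(B \<inter> ?j) \<inter> (C \<inter> ?j) \<subseteq> ?m \<inter> ?j \<and> (?m \<inter> B) \<inter> (?m \<inter> C) \<subseteq> ?m \<inter> ?j" by blast
next
  fix B C assume "B \<lessdot>\<^bsub>skeleton L\<^esub> C"
  then show "(B, C) \<in> dissection_tolerance L" by (rule skeleton_cover_tolerance)
next
  fix B C assume "B \<lessdot>\<^bsub>skeleton L\<^esub> C"
  then have blk: "B \<in> blocks L" "C \<in> blocks L" and ne: "B \<noteq> C" by (auto simp: covered_by_def S.lless_eq)
  \<comment> \<open>(MC8.2): by maximality, distinct blocks are incomparable under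
    inclusion.\<close>
  then have "\<not> B \<subseteq> C" "\<not> C \<subseteq> B" by (auto simp: blocks_def)
  then show "B \<inter> C \<noteq> carrier (L\<lparr>carrier := B\<rparr>) \<and> B \<inter> C \<noteq> carrier (L\<lparr>carrier := C\<rparr>)" by auto
qed simp_all

end

theorem theorem5p21:
  fixes L :: "('a, 'm) gorder_scheme"
  assumes "carrier L \<noteq> {}"
    and "modular_lattice L"
    and "lffc L"
  shows "modular_connected_system (skeleton L) (dissection_tolerance L)
    (\<lambda>B. L\<lparr>carrier := B\<rparr>)
    (\<lambda>B C. B \<inter> C) (\<lambda>B C. B \<inter> C) (\<lambda>B C. id)"
  using assms
  by (intro lffc_modular_lattice.modular_connected_system_blocks
      lffc_modular_lattice.intro lffc_modular_lattice_axioms.intro)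

end
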